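(* Let $c, k \ge 2$ and $n$ be any integers satisfying $n \ge 2k + c$. Then there exists a set $X$ of $n$ points in the plane $\mathbb{R}^2$ that cannot be covered by $k$ lines and such that the number of $c$-ordinary triangles spanned by $X$ is at most $2k^2 n$.
   Context: Let $X$ be a finite set of points in the plane. A line spanned (determined) by $X$, also called a connecting line, is a line passing through at least two points of $X$. For an integer $c \ge 2$, a line spanned by $X$ is called $c$-ordinary if it is incident to at most $c$ points of $X$. Three noncollinear points of $X$ form a $c$-ordinary triangle if each of the three lines determined by pairs of these points is $c$-ordinary (with respect to $X$). The number of $c$-ordinary triangles is the number of such unordered triples of points. $X$ is covered by $k$ lines if there are $k$ lines whose union contains $X$. *)

theory Defs
  imports "HOL-Analysis.Analysis"
begin

definition is_line :: "(real ^ 2) set \<Rightarrow> bool" where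
  "is_line L \<longleftrightarrow> affine L \<and> aff_dim L = 1"

definition connecting_line :: "(real ^ 2) set \<Rightarrow> (real ^ 2) set \<Rightarrow> bool" where
  "connecting_line X L \<longleftrightarrow> is_line L \<and> (\<exists>p\<in>X. \<exists>q\<in>X. p \<noteq> q \<and> p \<in> L \<and> q \<in> L)"

text \<open>Used for finite \<open>X\<close> only, so that \<open>card\<close> is the actual number of incident points.\<close>

definition ordinary_line :: "nat \<Rightarrow> (real ^ 2) set \<Rightarrow> (real ^ 2) set \<Rightarrow> bool" where
  "ordinary_line c X L \<longleftrightarrow> connecting_line X L \<and> card (L \<inter> X) \<le> c"

text \<open>For distinct points \<open>p\<close> and \<open>q\<close>, \<open>affine hull {p, q}\<close> is the line through them.\<close>

definition ordinary_triangle :: "nat \<Rightarrow> (real ^ 2) set \<Rightarrow> (real ^ 2) set \<Rightarrow> bool" where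
  "ordinary_triangle c X T \<longleftrightarrow>
     T \<subseteq> X \<and> card T = 3 \<and> \<not> collinear T \<and>
     (\<forall>p\<in>T. \<forall>q\<in>T. p \<noteq> q \<longrightarrow> ordinary_line c X (affine hull {p, q}))"

definition covered_by_lines :: "nat \<Rightarrow> (real ^ 2) set \<Rightarrow> bool" where
  "covered_by_lines k X \<longleftrightarrow>
     (\<exists>\<L>. finite \<L> \<and> card \<L> = k \<and> (\<forall>L\<in>\<L>. is_line L) \<and> X \<subseteq> \<Union>\<L>)"

end

theory Submission
  imports Defs
begin

text \<open>
  Put more than \<open>c\<close> of the points on one line \<open>L\<close> and the remaining \<open>2 * k - 1\<close> points off \<open>L\<close>, in
  such general position that every line other than \<open>L\<close> contains at most two points of \<open>X\<close>.

  Such a set is hard to cover by \<open>k\<close> lines. Without \<open>L\<close>, they catch at most \<open>2 * k\<close> points, and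
  there are more; with \<open>L\<close>, the other \<open>k - 1\<close> lines catch at most \<open>2 * k - 2\<close> of the \<open>2 * k - 1\<close>
  points off \<open>L\<close> (\<open>not_covered_by_lines\<close>). It has few ordinary triangles: since \<open>L\<close> is too rich to
  be a side, an ordinary triangle has at least two vertices off \<open>L\<close>. It is thus determined by a
  pair of the \<open>2 * k - 1\<close> points off \<open>L\<close> and one further point, for which there are at most
  \<open>(2 * k - 1) * (k - 1) * n\<close> choices (\<open>card_ordinary_triangles_le\<close>).

  An explicit configuration of this kind takes \<open>L\<close> to be the \<open>y\<close>-axis, with points at nonnegative
  heights, and places the other points on the right branch of the parabola \<open>y = x\<^sup>2\<close>: the chord
  through the points with abscissae \<open>s, t > 0\<close> meets the axis at height \<open>- s * t < 0\<close>
  (\<open>exists_points_on_line_and_parabola\<close>).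
\<close>

section \<open>Lines in the plane\<close>

lemma affine_hull_pair_eq_line:
  assumes "is_line L" "p \<in> L" "q \<in> L" "p \<noteq> q"
  shows "affine hull {p, q} = L"
proof (rule affine_dim_equal)
  show "affine hull {p, q} \<subseteq> L"
    using assms by (intro hull_minimal) (auto simp: is_line_def)
  show "aff_dim (affine hull {p, q}) = aff_dim L"
    using assms by (simp add: is_line_def aff_dim_2)
qed (use assms in \<open>auto simp: is_line_def\<close>)

lemma line_equation:
  assumes "is_line M"
  obtains a b d where "(a, b) \<noteq> (0, 0)" "M = {v. a * v $ 1 + b * v $ 2 = d}"
proof -
  have "aff_dim M = DIM(real ^ 2) - 1" "affine hull M = M"
    using assms by (auto simp: is_line_def hull_same)
  then obtain w d where w: "w \<noteq> 0" "M = {v. w \<bullet> v = d}"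
    using aff_dim_eq_hyperplane[of M] by metis
  show thesis
  proof
    show "(w $ 1, w $ 2) \<noteq> (0, 0)"
      using w(1) by (auto simp: vec_eq_iff forall_2)
    show "M = {v. w $ 1 * v $ 1 + w $ 2 * v $ 2 = d}"
      using w(2) by (simp add: inner_vec_def sum_2)
  qed
qed

text \<open>Three points on a line span a triangle of zero signed area. As a criterion for collinearity
  this is polynomial in the coordinates, and it factorises for points on the parabola below.\<close>

lemma line_triple_det_zero:
  assumes "is_line M" "p \<in> M" "q \<in> M" "r \<in> M"
  shows "(q $ 1 - p $ 1) * (r $ 2 - p $ 2) = (r $ 1 - p $ 1) * (q $ 2 - p $ 2)"
proof -
  obtain a b d where ab: "(a, b) \<noteq> (0, 0)" and M: "M = {v. a * v $ 1 + b * v $ 2 = d}"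
    using line_equation[OF assms(1)] by metis
  have q: "a * (q $ 1 - p $ 1) = - b * (q $ 2 - p $ 2)"
    and r: "a * (r $ 1 - p $ 1) = - b * (r $ 2 - p $ 2)"
    using assms(2-4) M by (auto simp: algebra_simps)
  let ?D = "(q $ 1 - p $ 1) * (r $ 2 - p $ 2) - (r $ 1 - p $ 1) * (q $ 2 - p $ 2)"
  have "a * ?D = 0" "b * ?D = 0"
    using q r by algebra+
  then show ?thesis
    using ab by auto
qed

lemma is_line_y_axis: "is_line {v. v $ 1 = 0}"
proof -
  have *: "{v :: real ^ 2. v $ 1 = 0} = {v. axis 1 1 \<bullet> v = 0}"
    by (simp add: inner_axis')
  show ?thesis
    unfolding is_line_def * by (simp add: affine_hyperplane aff_dim_hyperplane axis_eq_0_iff)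
qed

section \<open>Sets with one rich line and no other three collinear points\<close>

lemma card_le_of_cover:
  assumes "finite \<L>" "Y \<subseteq> \<Union>\<L>" "\<And>M. M \<in> \<L> \<Longrightarrow> card (M \<inter> Y) \<le> b"
  shows "card Y \<le> b * card \<L>"
proof -
  have "Y = (\<Union>M\<in>\<L>. M \<inter> Y)"
    using assms(2) by auto
  then have "card Y \<le> (\<Sum>M\<in>\<L>. card (M \<inter> Y))"
    using card_UN_le[OF assms(1), of "\<lambda>M. M \<inter> Y"] by simp
  also have "\<dots> \<le> b * card \<L>"
    using sum_bounded_above[of \<L> "\<lambda>M. card (M \<inter> Y)" b] assms(3) by (simp add: mult.commute)
  finally show ?thesis .
qed

lemma not_covered_by_lines:
  assumes "finite X"
    and two: "\<And>M. is_line M \<Longrightarrow> M \<noteq> L \<Longrightarrow> card (M \<inter> X) \<le> 2"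
    and "2 * k < card X" and "2 * k \<le> card (X - L) + 1"
  shows "\<not> covered_by_lines k X"
proof
  assume "covered_by_lines k X"
  then obtain \<L> where \<L>: "finite \<L>" "card \<L> = k" "\<forall>M\<in>\<L>. is_line M" "X \<subseteq> \<Union>\<L>"
    by (auto simp: covered_by_lines_def)
  show False
  proof (cases "L \<in> \<L>")
    case False
    then have "card X \<le> 2 * card \<L>"
      using \<L> two by (intro card_le_of_cover) auto
    then show False
      using assms(3) \<L>(2) by simp
  next
    case True
    have "card (M \<inter> (X - L)) \<le> 2" if "M \<in> \<L> - {L}" for M
    proof -
      have "card (M \<inter> (X - L)) \<le> card (M \<inter> X)"
        using \<open>finite X\<close> by (intro card_mono) auto
      then show ?thesis
        using two[of M] that \<L>(3) by force
    qed
    then have "card (X - L) \<le> 2 * card (\<L> - {L})"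
      using \<L> by (intro card_le_of_cover) auto
    moreover have "card (\<L> - {L}) = k - 1" "0 < k"
      using True \<L> by (auto simp: card_gt_0_iff)
    ultimately show False
      using assms(4) by linarith
  qed
qed

lemma card_ordinary_triangles_le:
  assumes "finite X" "is_line L" "c < card (L \<inter> X)"
  shows "card {T. ordinary_triangle c X T} \<le> (card (X - L) choose 2) * card X"
proof -
  let ?pairs = "{P. P \<subseteq> X - L \<and> card P = 2}"
  have "{T. ordinary_triangle c X T} \<subseteq> (\<lambda>(P, x). insert x P) ` (?pairs \<times> X)"
  proof
    fix T
    assume "T \<in> {T. ordinary_triangle c X T}"
    then have T: "T \<subseteq> X" "card T = 3"
      and sides: "\<And>p q. p \<in> T \<Longrightarrow> q \<in> T \<Longrightarrow> p \<noteq> q \<Longrightarrow> card (affine hull {p, q} \<inter> X) \<le> c"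
      by (auto simp: ordinary_triangle_def ordinary_line_def)
    have fin: "finite T"
      using T(2) by (simp add: card_ge_0_finite)
    have "p = q" if "p \<in> T \<inter> L" "q \<in> T \<inter> L" for p q
    proof (rule ccontr)
      assume "p \<noteq> q"
      then show False
        using sides[of p q] affine_hull_pair_eq_line[OF assms(2), of p q] that assms(3) by auto
    qed
    then have "card (T \<inter> L) \<le> 1"
      using fin by (auto simp: card_le_Suc0_iff_eq)
    moreover have "card T = card (T \<inter> L) + card (T - L)"
      using card_Int_Diff[OF fin] .
    ultimately have "2 \<le> card (T - L)"
      using T(2) by linarith
    then obtain P where P: "P \<subseteq> T - L" "card P = 2"
      by (metis obtain_subset_with_card_n)
    then have "card (T - P) = 1"
      using T(2) fin by (subst card_Diff_subset) (auto intro: finite_subset)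
    then obtain x where "T - P = {x}"
      by (auto simp: card_1_singleton_iff)
    then have "T = insert x P" "x \<in> X" "P \<in> ?pairs"
      using P T(1) by auto
    then show "T \<in> (\<lambda>(P, x). insert x P) ` (?pairs \<times> X)"
      by force
  qed
  moreover have "finite (?pairs \<times> X)"
    using \<open>finite X\<close> by simp
  ultimately have "card {T. ordinary_triangle c X T} \<le> card (?pairs \<times> X)"
    by (meson surj_card_le)
  also have "\<dots> = (card (X - L) choose 2) * card X"
    using n_subsets[of "X - L" 2] \<open>finite X\<close> by (simp add: card_cartesian_product)
  finally show ?thesis .
qed

section \<open>Points on an axis and on a parabola\<close>

text \<open>The determinant of \<open>line_triple_det_zero\<close> decides every case with at least two
  points of the parabola. For three of them it is a Vandermonde determinant. For two of them, with
  abscissae \<open>s\<close> and \<open>t\<close>, and the point of the axis at height \<open>h\<close>, it is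
  \<open>(t - s) * (s * t + h)\<close> up to sign, which cannot vanish when \<open>s \<noteq> t\<close>, \<open>s, t > 0\<close> and
  \<open>h \<ge> 0\<close>. Two points of the axis lie on no other line.\<close>

lemma exists_points_on_line_and_parabola:
  obtains X L :: "(real ^ 2) set"
  where "finite X" "is_line L" "card (L \<inter> X) = a" "card (X - L) = m"
    "\<And>M. is_line M \<Longrightarrow> M \<noteq> L \<Longrightarrow> card (M \<inter> X) \<le> 2"
proof
  define L :: "(real ^ 2) set" where "L = {v. v $ 1 = 0}"
  define A :: "(real ^ 2) set" where "A = (\<lambda>j. vector [0, real j]) ` {..<a}"
  define S :: "(real ^ 2) set" where "S = (\<lambda>i. vector [real (Suc i), real (Suc i) ^ 2]) ` {..<m}"
  have A: "v $ 1 = 0 \<and> 0 \<le> v $ 2" if "v \<in> A" for v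
    using that by (auto simp: A_def)
  have S: "0 < v $ 1 \<and> v $ 2 = (v $ 1) ^ 2" if "v \<in> S" for v
    using that by (auto simp: S_def)
  have eqI: "v = w" if "v $ 1 = w $ 1" "v $ 2 = w $ 2" for v w :: "real ^ 2"
    using that by (simp add: vec_eq_iff forall_2)
  show "finite (A \<union> S)"
    by (simp add: A_def S_def)
  show line: "is_line L"
    unfolding L_def by (rule is_line_y_axis)
  have "L \<inter> (A \<union> S) = A" "A \<union> S - L = S"
    using A S by (force simp: L_def)+
  moreover have "card A = a"
    unfolding A_def by (subst card_image) (auto simp: inj_on_def vec_eq_iff forall_2)
  moreover have "card S = m"
    unfolding S_def by (subst card_image) (auto simp: inj_on_def vec_eq_iff forall_2)
  ultimately show "card (L \<inter> (A \<union> S)) = a" "card (A \<union> S - L) = m"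
    by simp_all
  fix M
  assume M: "is_line M" "M \<noteq> L"
  have AA: "p = q" if "p \<in> M" "q \<in> M" "p \<in> A" "q \<in> A" for p q
    using affine_hull_pair_eq_line[OF M(1), of p q] affine_hull_pair_eq_line[OF line, of p q]
      that A M(2) by (auto simp: L_def)
  have SS: "r \<notin> A" if "p \<in> M" "q \<in> M" "r \<in> M" "p \<in> S" "q \<in> S" "p \<noteq> q" for p q r
  proof
    assume "r \<in> A"
    have "(q $ 1 - p $ 1) * (p $ 1 * q $ 1 + r $ 2) = 0"
      using line_triple_det_zero[OF M(1), of p q r] that A[OF \<open>r \<in> A\<close>] S[of p] S[of q]
      by (auto simp: algebra_simps power2_eq_square)
    moreover have "0 < p $ 1 * q $ 1 + r $ 2"
      using A[OF \<open>r \<in> A\<close>] S[OF \<open>p \<in> S\<close>] S[OF \<open>q \<in> S\<close>] by (simp add: add_pos_nonneg)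
    ultimately show False
      using eqI[of p q] S that by auto
  qed
  have SSS: "p = q \<or> q = r \<or> p = r" if "p \<in> M" "q \<in> M" "r \<in> M" "p \<in> S" "q \<in> S" "r \<in> S" for p q r
  proof -
    have "(q $ 1 - p $ 1) * (r $ 1 - p $ 1) * (r $ 1 - q $ 1) = 0"
      using line_triple_det_zero[OF M(1), of p q r] that S[of p] S[of q] S[of r]
      by (auto simp: algebra_simps power2_eq_square)
    then show ?thesis
      using eqI S that by auto
  qed
  show "card (M \<inter> (A \<union> S)) \<le> 2"
  proof (rule ccontr)
    assume "\<not> ?thesis"
    then have "3 \<le> card (M \<inter> (A \<union> S))"
      by simp
    then obtain T where "T \<subseteq> M \<inter> (A \<union> S)" "card T = 3"
      by (metis obtain_subset_with_card_n)
    then obtain p q r where "p \<in> M" "q \<in> M" "r \<in> M" "p \<in> A \<union> S" "q \<in> A \<union> S" "r \<in> A \<union> S"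
      "p \<noteq> q" "q \<noteq> r" "p \<noteq> r"
      by (auto simp: card_3_iff)
    then show False
      using AA SS SSS by (metis Un_iff)
  qed
qed

section \<open>Few ordinary triangles without a small line cover\<close>

theorem proposition1:
  fixes c k n :: nat
  assumes "c \<ge> 2" and "k \<ge> 2" and "n \<ge> 2 * k + c"
  shows "\<exists>X :: (real ^ 2) set. finite X \<and> card X = n \<and>
           \<not> covered_by_lines k X \<and>
           card {T. ordinary_triangle c X T} \<le> 2 * k ^ 2 * n"
proof -
  obtain X L :: "(real ^ 2) set"
    where X: "finite X" "is_line L" "card (L \<inter> X) = n - (2 * k - 1)" "card (X - L) = 2 * k - 1"
      and two: "\<And>M. is_line M \<Longrightarrow> M \<noteq> L \<Longrightarrow> card (M \<inter> X) \<le> 2"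
    using exists_points_on_line_and_parabola by blast
  have "card X = card (X \<inter> L) + card (X - L)"
    using card_Int_Diff[OF X(1)] .
  then have n: "card X = n"
    using X(3,4) assms by (simp add: Int_commute)
  have "\<not> covered_by_lines k X"
    using not_covered_by_lines[OF X(1) two, where k = k] X(4) n assms by auto
  moreover have "card {T. ordinary_triangle c X T} \<le> 2 * k ^ 2 * n"
  proof -
    have "c < card (L \<inter> X)"
      using X(3) assms by linarith
    then have "card {T. ordinary_triangle c X T} \<le> (2 * k - 1 choose 2) * n"
      using card_ordinary_triangles_le[OF X(1,2)] X(4) n by simp
    also have "(2 * k - 1 choose 2) = (2 * k - 1) * (2 * (k - 1)) div 2"
      by (simp add: choose_two diff_mult_distrib2)
    also have "\<dots> = (2 * k - 1) * (k - 1)"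
      by simp
    also have "\<dots> \<le> (2 * k) * k"
      by (intro mult_mono) auto
    finally show ?thesis
      by (simp add: power2_eq_square)
  qed
  ultimately show ?thesis
    using X(1) n by blast
qed

end
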